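(* Suppose that $f(\cdot;\xi)$ is $L$-smooth for every realization of $\xi$ (with $L>0$; no convexity is assumed). Let $w_0\in\mathbb{R}^d$ be given with $\mathbb{E}[\|\nabla f(w_0;\xi)\|^2]$ finite. Let $\tilde w$ be the output of iSARAH-IN$(w_0,\eta,m,b)$ with learning rate $\eta$ of order $\frac{1}{L\sqrt{m+1}}$, namely $\frac{c}{L\sqrt{m+1}}\le\eta\le\frac{2}{L(\sqrt{1+4m}+1)}$ for a constant $c>0$ independent of $m$, and with sample size $b=\sqrt{m+1}$, where $m$ (such that $\sqrt{m+1}$ is an integer) is the total number of iterations. Then $\|\nabla F(\tilde w)\|^2$ converges sublinearly in expectation with rate $$\mathbb{E}[\|\nabla F(\tilde w)\|^2]=\mathcal{O}\left(\sqrt{\frac{1}{m+1}}\right),$$ and therefore the total complexity to achieve an $\epsilon$-accurate solution, i.e. $\mathbb{E}[\|\nabla F(\tilde w)\|^2]\le\epsilon$ (for a suitable choice of $m$ depending on $\epsilon$), is $\mathcal{O}(1/\epsilon^2)$.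
   Context: $\xi$ is a random variable; for each realization, $f(\cdot;\xi):\mathbb{R}^d\to\mathbb{R}$ is differentiable; $F(w)=\mathbb{E}[f(w;\xi)]$ is bounded below, and $\mathbb{E}[\nabla f(w;\xi)]=\nabla F(w)$ for every fixed $w\in\mathbb{R}^d$. $\|\cdot\|$ is the Euclidean norm. $L$-smooth for every realization means $\|\nabla f(w;\xi)-\nabla f(w';\xi)\|\le L\|w-w'\|$ for all $w,w'\in\mathbb{R}^d$ and every realization of $\xi$. The procedure iSARAH-IN$(w_0,\eta,m,b)$ has parameters $\eta>0$ and positive integers $m,b$. Let $\zeta_1,\dots,\zeta_b,\xi_1,\xi_2,\dots$ be i.i.d. copies of $\xi$, independent of $w_0$. Set $$v_0=\frac1b\sum_{i=1}^b\nabla f(w_0;\zeta_i),\qquad w_1=w_0-\eta v_0,$$ and for $t\ge 1$ $$v_t=\nabla f(w_t;\xi_t)-\nabla f(w_{t-1};\xi_t)+v_{t-1},\qquad w_{t+1}=w_t-\eta v_t.$$ The output is $\tilde w=w_t$ with $t$ chosen uniformly at random from $\{0,1,\dots,m\}$, independently of everything else. The total complexity of one run is its number of stochastic gradient evaluations, counted as $b+2m$. The $\mathcal{O}(\cdot)$ in the complexity is for $\epsilon\to0$; hidden constants may depend on $L$, $c$, $F(w_0)-F^*$ (with $F^*$ a lower bound of $F$) and $\mathbb{E}[\|\nabla f(w_0;\xi)\|^2]$, but not on $m$ or $\epsilon$. *)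

theory Defs
  imports "HOL-Probability.Probability"
begin

text \<open>
  Only meaningful where \<^term>\<open>g\<close> is differentiable; the vector is then unique.
\<close>

definition grad :: "('a::real_inner \<Rightarrow> real) \<Rightarrow> 'a \<Rightarrow> 'a" where
  "grad g w = (THE v. GDERIV g w :> v)"

text \<open>
  \<open>D\<close> is the law of the random variable \<open>\<xi>\<close>, and the realizations of \<open>\<xi>\<close> are the points of
  \<^term>\<open>space D\<close>.
\<close>

definition objective :: "'x measure \<Rightarrow> ('a \<Rightarrow> 'x \<Rightarrow> real) \<Rightarrow> 'a \<Rightarrow> real" where
  "objective D f w = (\<integral>x. f w x \<partial>D)"

definition stoch_grad :: "('a::real_inner \<Rightarrow> 'x \<Rightarrow> real) \<Rightarrow> 'a \<Rightarrow> 'x \<Rightarrow> 'a" where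
  "stoch_grad f w x = grad (\<lambda>u. f u x) w"

locale stochastic_problem = prob_space D
  for D :: "'x measure" +
  fixes f :: "real ^ 'd \<Rightarrow> 'x \<Rightarrow> real"
  assumes differentiable_realization:
      "\<And>x w. x \<in> space D \<Longrightarrow> (\<lambda>u. f u x) differentiable (at w)"
    and integrable_f: "\<And>w. integrable D (f w)"
    and objective_bounded_below: "bdd_below (range (objective D f))"
    and differentiable_objective: "\<And>w. objective D f differentiable (at w)"
    and integrable_grad: "\<And>w. integrable D (stoch_grad f w)"
    and unbiased: "\<And>w. (\<integral>x. stoch_grad f w x \<partial>D) = grad (objective D f) w"

definition smooth_realizations ::
    "'x measure \<Rightarrow> ('a::real_inner \<Rightarrow> 'x \<Rightarrow> real) \<Rightarrow> real \<Rightarrow> bool" where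
  "smooth_realizations D f L \<longleftrightarrow>
     (\<forall>x\<in>space D. \<forall>w w'. norm (stoch_grad f w x - stoch_grad f w' x) \<le> L * norm (w - w'))"

text \<open>
  The recursion along one sample path: \<open>z 1, \<dots>, z b\<close> are the values of the initial samples
  \<open>\<zeta>\<close>, and \<open>x 1, x 2, \<dots>\<close> those of the samples \<open>\<xi>\<close> of the inner loop.
\<close>

function
  isarah_w :: "('a::real_inner \<Rightarrow> 'x \<Rightarrow> real) \<Rightarrow> 'a \<Rightarrow> real \<Rightarrow> nat \<Rightarrow> (nat \<Rightarrow> 'x) \<Rightarrow> (nat \<Rightarrow> 'x)
    \<Rightarrow> nat \<Rightarrow> 'a"
and
  isarah_v :: "('a::real_inner \<Rightarrow> 'x \<Rightarrow> real) \<Rightarrow> 'a \<Rightarrow> real \<Rightarrow> nat \<Rightarrow> (nat \<Rightarrow> 'x) \<Rightarrow> (nat \<Rightarrow> 'x)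
    \<Rightarrow> nat \<Rightarrow> 'a"
where
  "isarah_w f w0 \<eta> b z x 0 = w0"
| "isarah_w f w0 \<eta> b z x (Suc t) =
     isarah_w f w0 \<eta> b z x t - \<eta> *\<^sub>R isarah_v f w0 \<eta> b z x t"
| "isarah_v f w0 \<eta> b z x 0 = (1 / real b) *\<^sub>R (\<Sum>i = 1..b. stoch_grad f w0 (z i))"
| "isarah_v f w0 \<eta> b z x (Suc t) =
     stoch_grad f (isarah_w f w0 \<eta> b z x (Suc t)) (x (Suc t))
     - stoch_grad f (isarah_w f w0 \<eta> b z x t) (x (Suc t))
     + isarah_v f w0 \<eta> b z x t"
  by pat_completeness auto
termination
  by (relation "Wellfounded.measure (case_sum (\<lambda>(f, w0, \<eta>, b, z, x, t). 2 * t)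
                                  (\<lambda>(f, w0, \<eta>, b, z, x, t). 2 * t + 1))") auto

text \<open>
  The randomness of one run, on an arbitrary probability space \<open>M\<close>: \<open>\<zeta>\<close> and \<open>\<xi>\<close> are indexed
  jointly by \<^typ>\<open>nat + nat\<close>, and \<open>T\<close> is the index of the returned iterate.  As \<open>T\<close> and
  the samples have values in different types, their independence is stated for the generated
  sigma-algebras rather than with \<open>indep_var\<close>.
\<close>

definition sample_index :: "nat \<Rightarrow> (nat + nat) set" where
  "sample_index b = Inl ` {1..b} \<union> Inr ` {1..}"

locale isarah_randomness = prob_space M
  for M :: "'w measure" +
  fixes D :: "'x measure" and m b :: nat
    and \<zeta> \<xi> :: "nat \<Rightarrow> 'w \<Rightarrow> 'x" and T :: "'w \<Rightarrow> nat"
  assumes samples_indep: "indep_vars (\<lambda>_. D) (case_sum \<zeta> \<xi>) (sample_index b)"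
    and samples_law: "\<And>j. j \<in> sample_index b \<Longrightarrow> distr M D (case_sum \<zeta> \<xi> j) = D"
    and index_measurable: "T \<in> measurable M (count_space UNIV)"
    and index_law: "distr M (count_space UNIV) T = measure_pmf (pmf_of_set {0..m})"
    and index_indep:
      "indep_set {T -` A \<inter> space M | A. True}
         {(\<lambda>\<omega>. \<lambda>j\<in>sample_index b. case_sum \<zeta> \<xi> j \<omega>) -` B \<inter> space M | B.
            B \<in> sets (\<Pi>\<^sub>M j\<in>sample_index b. D)}"

definition isarah_output ::
    "('a::real_inner \<Rightarrow> 'x \<Rightarrow> real) \<Rightarrow> 'a \<Rightarrow> real \<Rightarrow> nat
     \<Rightarrow> (nat \<Rightarrow> 'w \<Rightarrow> 'x) \<Rightarrow> (nat \<Rightarrow> 'w \<Rightarrow> 'x) \<Rightarrow> ('w \<Rightarrow> nat) \<Rightarrow> 'w \<Rightarrow> 'a" where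
  "isarah_output f w0 \<eta> b \<zeta> \<xi> T \<omega> = isarah_w f w0 \<eta> b (\<lambda>i. \<zeta> i \<omega>) (\<lambda>t. \<xi> t \<omega>) (T \<omega>)"

text \<open>Number of stochastic gradient evaluations of one run.\<close>

definition total_complexity :: "nat \<Rightarrow> nat \<Rightarrow> nat" where
  "total_complexity m b = b + 2 * m"

definition step_lower :: "real \<Rightarrow> real \<Rightarrow> nat \<Rightarrow> real" where
  "step_lower L c m = c / (L * sqrt (real m + 1))"

definition step_upper :: "real \<Rightarrow> nat \<Rightarrow> real" where
  "step_upper L m = 2 / (L * (sqrt (1 + 4 * real m) + 1))"

end

theory Submission
  imports Defs
begin

text \<open>
  Write \<open>e t = v t - \<nabla>F (w t)\<close>.  The descent lemma for the \<open>L\<close>-smooth function \<open>F\<close> and polarization give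
  \<open>F (w (t+1)) \<le> F (w t) - \<eta>/2 \<parallel>\<nabla>F (w t)\<parallel>\<^sup>2 + \<eta>/2 \<parallel>e t\<parallel>\<^sup>2 - \<eta>/2 (1 - L \<eta>) \<parallel>v t\<parallel>\<^sup>2\<close> along every path.
  The errors \<open>e t\<close> form a martingale whose increments are bounded in mean square by
  \<open>(L \<eta>)\<^sup>2 E \<parallel>v t\<parallel>\<^sup>2\<close>, and \<open>E \<parallel>e 0\<parallel>\<^sup>2 \<le> E \<parallel>\<nabla>f (w0; \<xi>)\<parallel>\<^sup>2 / b\<close>.  Summing over \<open>t \<le> m\<close>, the terms
  in \<open>E \<parallel>v t\<parallel>\<^sup>2\<close> add up to at most zero because the upper bound on \<open>\<eta>\<close> is the positive root of
  \<open>m (L \<eta>)\<^sup>2 = 1 - L \<eta>\<close>.  Independence is used in the form of Fubini's theorem: the samples are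
  transported to a product space, where one coordinate at a time is integrated out.
\<close>

subsection \<open>Gradients\<close>

text \<open>Riesz representation in coordinates: a linear functional on a Euclidean space is the
  inner product with the vector of its values on \<open>Basis\<close>. Uniqueness of the derivative
  then justifies the definite description in \<open>grad\<close>.\<close>

lemma GDERIV_grad:
  fixes g :: "'a::euclidean_space \<Rightarrow> real"
  assumes "g differentiable (at w)"
  shows "GDERIV g w :> grad g w"
proof -
  obtain g' where g': "(g has_derivative g') (at w)"
    using assms by (auto simp: differentiable_def)
  define v where "v = (\<Sum>i\<in>Basis. g' i *\<^sub>R i)"
  have lin: "linear g'"
    using g' has_derivative_linear by blast
  have "g' = (\<lambda>h. h \<bullet> v)"
  proof
    fix h
    have "g' h = g' (\<Sum>i\<in>Basis. (h \<bullet> i) *\<^sub>R i)"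
      by (simp add: euclidean_representation)
    also have "\<dots> = h \<bullet> v"
      by (simp add: linear_sum[OF lin] linear_cmul[OF lin] v_def inner_sum_right mult.commute)
    finally show "g' h = h \<bullet> v" .
  qed
  with g' have v: "GDERIV g w :> v"
    by (simp add: gderiv_def)
  moreover have "u = v" if "GDERIV g w :> u" for u
  proof -
    have "(\<lambda>h. h \<bullet> u) = (\<lambda>h. h \<bullet> v)"
      using that v unfolding gderiv_def by (rule has_derivative_unique)
    then show ?thesis
      by (metis inner_commute vector_eq_ldot)
  qed
  ultimately show ?thesis
    unfolding grad_def by (rule theI)
qed

lemma descent_lemma:
  fixes g :: "'a::euclidean_space \<Rightarrow> real"
  assumes diff: "\<And>u. g differentiable (at u)"
    and lip: "\<And>u v. norm (grad g u - grad g v) \<le> L * norm (u - v)"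
  shows "g (w + d) \<le> g w + grad g w \<bullet> d + L / 2 * (norm d)\<^sup>2"
proof -
  \<comment> \<open>On the segment from \<open>w\<close> to \<open>w + d\<close>,
    \<open>\<psi>\<close> is \<open>g\<close> minus its linear part and the quadratic correction.
    Cauchy-Schwarz and the Lipschitz bound make its derivative nonpositive, so comparing its values
    at 0 and 1 gives the claim.\<close>
  define \<psi> where
    "\<psi> s = g (w + s *\<^sub>R d) - s * (grad g w \<bullet> d) - L / 2 * (norm d)\<^sup>2 * s\<^sup>2" for s
  have "\<psi> 1 \<le> \<psi> 0"
  proof (rule DERIV_nonpos_imp_nonincreasing[where f = \<psi>])
    fix s :: real
    assume s: "0 \<le> s" "s \<le> 1"
    have "((\<lambda>s. g (w + s *\<^sub>R d)) has_derivative (\<lambda>h. (h *\<^sub>R d) \<bullet> grad g (w + s *\<^sub>R d))) (at s)"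
      by (rule has_derivative_compose[of "\<lambda>s. w + s *\<^sub>R d" _ _ _ g])
         (auto intro!: derivative_eq_intros GDERIV_grad[unfolded gderiv_def] diff)
    then have *: "((\<lambda>s. g (w + s *\<^sub>R d)) has_real_derivative grad g (w + s *\<^sub>R d) \<bullet> d) (at s)"
      by (simp add: has_field_derivative_def inner_commute mult.commute[of _ "_ \<bullet> _"])
    let ?y = "grad g (w + s *\<^sub>R d) \<bullet> d - grad g w \<bullet> d - L * (norm d)\<^sup>2 * s"
    have "(\<psi> has_real_derivative ?y) (at s)"
      unfolding \<psi>_def by (auto intro!: derivative_eq_intros *)
    moreover have "?y \<le> 0"
    proof -
      have "(grad g (w + s *\<^sub>R d) - grad g w) \<bullet> d \<le> norm (grad g (w + s *\<^sub>R d) - grad g w) * norm d"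
        by (rule norm_cauchy_schwarz)
      also have "\<dots> \<le> (L * norm (s *\<^sub>R d)) * norm d"
        using lip[of "w + s *\<^sub>R d" w] by (intro mult_right_mono) auto
      also have "\<dots> = L * (norm d)\<^sup>2 * s"
        using s by (simp add: power2_eq_square)
      finally show ?thesis
        by (simp add: inner_diff_left)
    qed
    ultimately show "\<exists>y. (\<psi> has_real_derivative y) (at s) \<and> y \<le> 0"
      by blast
  qed simp
  then show ?thesis
    by (simp add: \<psi>_def)
qed

text \<open>Simple functions approximate \<open>W\<close> pointwise. For a simple function the
  composition is measurable because its range is finite, and continuity of \<open>g\<close> in its
  first argument carries measurability to the limit. This makes stochastic gradients at random
  iterates measurable.\<close>

lemma borel_measurable_Caratheodory:
  fixes g :: "'a::{metric_space, second_countable_topology} \<Rightarrow> 'x \<Rightarrow> 'b::{metric_space, second_countable_topology}"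
  assumes W: "W \<in> borel_measurable N" and X: "X \<in> measurable N D"
    and g: "\<And>w. g w \<in> borel_measurable D"
    and cont: "\<And>x. x \<in> space D \<Longrightarrow> continuous_on UNIV (\<lambda>w. g w x)"
  shows "(\<lambda>s. g (W s) (X s)) \<in> borel_measurable N"
proof -
  obtain F where F: "\<And>i. simple_function N (F i)"
      "\<And>s. s \<in> space N \<Longrightarrow> (\<lambda>i. F i s) \<longlonglongrightarrow> W s"
    using borel_measurable_implies_sequence_metric[OF W, of undefined] by blast
  show ?thesis
  proof (rule borel_measurable_LIMSEQ_metric)
    fix i
    have F_i: "F i \<in> measurable N (count_space (F i ` space N))"
      using F(1)[of i] by (simp add: simple_function_def measurable_count_space_eq2)
    show "(\<lambda>s. g (F i s) (X s)) \<in> borel_measurable N"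
    proof (rule measurable_compose_countable'[where f = "\<lambda>w s. g w (X s)"])
      show "countable (F i ` space N)"
        using F(1)[of i] by (simp add: simple_function_def countable_finite)
    qed (rule F_i measurable_compose[OF X g])+
  next
    fix s assume s: "s \<in> space N"
    then have "X s \<in> space D"
      using X by (auto dest: measurable_space)
    from cont[OF this] have "isCont (\<lambda>w. g w (X s)) (W s)"
      by (simp add: continuous_on_eq_continuous_at)
    then show "(\<lambda>i. g (F i s) (X s)) \<longlonglongrightarrow> g (W s) (X s)"
      using F(2)[OF s] by (rule isCont_tendsto_compose)
  qed
qed

subsection \<open>Square integrability and resampling of one coordinate\<close>

text \<open>Measurability of \<open>X\<close> is a separate conjunct, since integrability of the
  squared norm does not imply it.\<close>

definition square_integrable :: "'a measure \<Rightarrow> ('a \<Rightarrow> 'b::euclidean_space) \<Rightarrow> bool" where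
  "square_integrable N X \<longleftrightarrow> X \<in> borel_measurable N \<and> integrable N (\<lambda>s. (norm (X s))\<^sup>2)"

lemma square_integrable_bound:
  assumes "square_integrable N Y" "X \<in> borel_measurable N"
    and "\<And>s. s \<in> space N \<Longrightarrow> norm (X s) \<le> C * norm (Y s)"
  shows "square_integrable N X"
  unfolding square_integrable_def
proof (intro conjI assms)
  show "integrable N (\<lambda>s. (norm (X s))\<^sup>2)"
  proof (rule Bochner_Integration.integrable_bound)
    show "integrable N (\<lambda>s. C\<^sup>2 * (norm (Y s))\<^sup>2)"
      using assms by (simp add: square_integrable_def)
    show "AE s in N. norm ((norm (X s))\<^sup>2) \<le> norm (C\<^sup>2 * (norm (Y s))\<^sup>2)"
    proof (rule AE_I2)
      fix s assume "s \<in> space N"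
      then have "(norm (X s))\<^sup>2 \<le> (C * norm (Y s))\<^sup>2"
        using assms(3) by (intro power_mono) auto
      then show "norm ((norm (X s))\<^sup>2) \<le> norm (C\<^sup>2 * (norm (Y s))\<^sup>2)"
        by (simp add: power_mult_distrib)
    qed
  qed (use assms(2) in measurable)
qed

lemma square_integrable_inner:
  assumes "square_integrable N X" "square_integrable N Y"
  shows "integrable N (\<lambda>s. X s \<bullet> Y s)"
proof (rule Bochner_Integration.integrable_bound)
  show "integrable N (\<lambda>s. (norm (X s))\<^sup>2 + (norm (Y s))\<^sup>2)"
    using assms by (simp add: square_integrable_def)
  show "AE s in N. norm (X s \<bullet> Y s) \<le> norm ((norm (X s))\<^sup>2 + (norm (Y s))\<^sup>2)"
  proof (rule AE_I2)
    fix s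
    have "\<bar>X s \<bullet> Y s\<bar> \<le> norm (X s) * norm (Y s)"
      by (rule Cauchy_Schwarz_ineq2)
    also have "\<dots> \<le> (norm (X s))\<^sup>2 + (norm (Y s))\<^sup>2"
      using sum_squares_bound[of "norm (X s)" "norm (Y s)"]
        mult_nonneg_nonneg[OF norm_ge_zero norm_ge_zero, of "X s" "Y s"] by linarith
    finally show "norm (X s \<bullet> Y s) \<le> norm ((norm (X s))\<^sup>2 + (norm (Y s))\<^sup>2)"
      by simp
  qed
qed (use assms in \<open>auto simp: square_integrable_def\<close>)

lemma power2_norm_add:
  "(norm (x + y))\<^sup>2 = (norm x)\<^sup>2 + 2 * (x \<bullet> y) + (norm y)\<^sup>2"
  by (simp add: power2_norm_eq_inner inner_add_left inner_add_right inner_commute)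

lemma square_integrable_add:
  assumes "square_integrable N X" "square_integrable N Y"
  shows "square_integrable N (\<lambda>s. X s + Y s)"
  using assms square_integrable_inner[OF assms]
  by (simp add: square_integrable_def borel_measurable_add power2_norm_add)

lemma square_integrable_scaleR:
  "square_integrable N X \<Longrightarrow> square_integrable N (\<lambda>s. c *\<^sub>R X s)"
  by (rule square_integrable_bound[of N X _ "\<bar>c\<bar>"]) (auto simp: square_integrable_def)

lemma square_integrable_diff:
  assumes "square_integrable N X" "square_integrable N Y"
  shows "square_integrable N (\<lambda>s. X s - Y s)"
  using square_integrable_add[OF assms(1) square_integrable_scaleR[OF assms(2), of "-1"]] by simp

lemma (in prob_space) square_integrable_const: "square_integrable M (\<lambda>_. c)"
  by (simp add: square_integrable_def)

lemma square_integrable_sum: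
  assumes "\<And>i. i \<in> I \<Longrightarrow> square_integrable N (X i)"
  shows "square_integrable N (\<lambda>s. \<Sum>i\<in>I. X i s)"
  using assms
proof (induction I rule: infinite_finite_induct)
  case (insert i I)
  then show ?case
    by (simp add: square_integrable_add)
qed (auto simp: square_integrable_def)

text \<open>Fubini: a point of the product space is distributed like \<open>X(j := y)\<close> with
  \<open>y\<close> drawn from \<open>M\<close> independently of the other coordinates
  \<open>X\<close>. The last assumption says that the conditional expectation of \<open>h\<close>
  given these coordinates vanishes.\<close>

lemma (in prob_space) integral_PiM_resample:
  fixes h :: "('i \<Rightarrow> 'a) \<Rightarrow> real"
  assumes j: "j \<in> J" and h: "integrable (\<Pi>\<^sub>M i\<in>J. M) h"
    and z: "\<And>s. s \<in> space (\<Pi>\<^sub>M i\<in>J. M) \<Longrightarrow> (\<integral>y. h (s(j := y)) \<partial>M) = 0"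
  shows "(\<integral>s. h s \<partial>(\<Pi>\<^sub>M i\<in>J. M)) = 0"
proof -
  define Q where "Q = (\<Pi>\<^sub>M i\<in>J - {j}. M)"
  interpret Q: prob_space Q
    unfolding Q_def by (intro prob_space_PiM) (rule prob_space_axioms)
  interpret pair_sigma_finite M Q ..
  have J: "insert j (J - {j}) = J"
    using j by auto
  have eq: "(\<Pi>\<^sub>M i\<in>J. M) = distr (M \<Otimes>\<^sub>M Q) (\<Pi>\<^sub>M i\<in>J. M) (\<lambda>(y, X). X(j := y))"
    using distr_pair_PiM_eq_PiM[of "J - {j}" "\<lambda>_. M" j, unfolded J] prob_space_axioms
    by (simp add: Q_def)
  have meas: "(\<lambda>(y, X). X(j := y)) \<in> measurable (M \<Otimes>\<^sub>M Q) (\<Pi>\<^sub>M i\<in>J. M)"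
    unfolding Q_def split_beta' by (rule measurable_fun_upd[where J = "J - {j}"]) (use J in auto)
  have int: "integrable (M \<Otimes>\<^sub>M Q) (\<lambda>(y, X). h (X(j := y)))"
    using integrable_distr[OF meas, of h] eq h by (simp add: case_prod_beta')
  have "(\<integral>s. h s \<partial>(\<Pi>\<^sub>M i\<in>J. M)) = (\<integral>p. (case p of (y, X) \<Rightarrow> h (X(j := y))) \<partial>(M \<Otimes>\<^sub>M Q))"
    using h by (subst eq, subst integral_distr[OF meas]) (auto simp: case_prod_beta')
  also have "\<dots> = (\<integral>X. (\<integral>y. h (X(j := y)) \<partial>M) \<partial>Q)"
    by (rule integral_snd[OF int, symmetric])
  also have "\<dots> = (\<integral>X. 0 \<partial>Q)"
  proof (rule Bochner_Integration.integral_cong)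
    fix X assume X: "X \<in> space Q"
    \<comment> \<open>\<open>X\<close> has no coordinate \<open>j\<close>. Filling it with an
      arbitrary \<open>y0\<close> gives a point of the full product, and the update by
      \<open>y\<close> overwrites that value.\<close>
    obtain y0 where "y0 \<in> space M"
      using not_empty by blast
    with X have "X(j := y0) \<in> space (\<Pi>\<^sub>M i\<in>J. M)"
      using j by (auto simp: Q_def space_PiM PiE_iff extensional_def)
    from z[OF this] show "(\<integral>y. h (X(j := y)) \<partial>M) = 0"
      by simp
  qed simp
  finally show ?thesis
    by simp
qed

text \<open>
  \<open>C\<close> plays the role of the conditional expectation of \<open>X\<close> given all coordinates except \<open>j\<close>.
\<close>

lemma (in prob_space) second_moment_add_centered_le:
  fixes A X C :: "('i \<Rightarrow> 'a) \<Rightarrow> 'e::euclidean_space"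
  assumes j: "j \<in> J"
    and A: "square_integrable (\<Pi>\<^sub>M i\<in>J. M) A"
    and X: "square_integrable (\<Pi>\<^sub>M i\<in>J. M) X"
    and C: "square_integrable (\<Pi>\<^sub>M i\<in>J. M) C"
    and inv: "\<And>s y. A (s(j := y)) = A s" "\<And>s y. C (s(j := y)) = C s"
    and X': "\<And>s. s \<in> space (\<Pi>\<^sub>M i\<in>J. M) \<Longrightarrow> integrable M (\<lambda>y. X (s(j := y)))"
      "\<And>s. s \<in> space (\<Pi>\<^sub>M i\<in>J. M) \<Longrightarrow> (\<integral>y. X (s(j := y)) \<partial>M) = C s"
  shows "(\<integral>s. (norm (A s + (X s - C s)))\<^sup>2 \<partial>(\<Pi>\<^sub>M i\<in>J. M)) \<le>
    (\<integral>s. (norm (A s))\<^sup>2 \<partial>(\<Pi>\<^sub>M i\<in>J. M)) + (\<integral>s. (norm (X s))\<^sup>2 \<partial>(\<Pi>\<^sub>M i\<in>J. M))"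
proof -
  let ?P = "\<Pi>\<^sub>M i\<in>J. M"
  have XC: "square_integrable ?P (\<lambda>s. X s - C s)"
    by (intro square_integrable_diff X C)
  \<comment> \<open>A function that ignores coordinate \<open>j\<close> is orthogonal to the
    centered \<open>X - C\<close>. With \<open>U = A\<close> this removes the cross term; with
    \<open>U = C\<close> it shows that centering does not increase the second moment of
    \<open>X\<close>.\<close>
  have orth: "(\<integral>s. U s \<bullet> (X s - C s) \<partial>?P) = 0"
    if U: "square_integrable ?P U" and U_inv: "\<And>s y. U (s(j := y)) = U s" for U
  proof (rule integral_PiM_resample[OF j])
    show "integrable ?P (\<lambda>s. U s \<bullet> (X s - C s))"
      by (intro square_integrable_inner U XC)
    fix s assume s: "s \<in> space ?P"
    show "(\<integral>y. U (s(j := y)) \<bullet> (X (s(j := y)) - C (s(j := y))) \<partial>M) = 0"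
      using X'[OF s] by (simp add: U_inv inv prob_space)
  qed
  have int: "integrable ?P (\<lambda>s. (norm (A s))\<^sup>2)" "integrable ?P (\<lambda>s. (norm (X s))\<^sup>2)"
      "integrable ?P (\<lambda>s. (norm (C s))\<^sup>2)" "integrable ?P (\<lambda>s. (norm (X s - C s))\<^sup>2)"
    using A X C XC by (auto simp: square_integrable_def)
  note int_inner = square_integrable_inner[OF A XC] square_integrable_inner[OF C XC]
  have "(\<integral>s. (norm (A s + (X s - C s)))\<^sup>2 \<partial>?P) =
      (\<integral>s. (norm (A s))\<^sup>2 + 2 * (A s \<bullet> (X s - C s)) + (norm (X s - C s))\<^sup>2 \<partial>?P)"
    by (simp only: power2_norm_add)
  also have "\<dots> = (\<integral>s. (norm (A s))\<^sup>2 \<partial>?P) + (\<integral>s. (norm (X s - C s))\<^sup>2 \<partial>?P)"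
    using int int_inner orth[OF A inv(1)] by simp
  also have "(\<integral>s. (norm (X s - C s))\<^sup>2 \<partial>?P) \<le> (\<integral>s. (norm (X s))\<^sup>2 \<partial>?P)"
  proof -
    have "(\<integral>s. (norm (X s))\<^sup>2 \<partial>?P) =
        (\<integral>s. (norm (C s))\<^sup>2 + 2 * (C s \<bullet> (X s - C s)) + (norm (X s - C s))\<^sup>2 \<partial>?P)"
      by (simp flip: power2_norm_add)
    also have "\<dots> = (\<integral>s. (norm (C s))\<^sup>2 \<partial>?P) + (\<integral>s. (norm (X s - C s))\<^sup>2 \<partial>?P)"
      using int int_inner orth[OF C inv(2)] by simp
    finally show ?thesis
      by simp
  qed
  finally show ?thesis
    by simp
qed

subsection \<open>Second moments along a run\<close>

text \<open>With \<open>u = L * \<eta>\<close>, the expression \<open>m * u^2 + u\<close> increases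
  in \<open>u \<ge> 0\<close> and equals 1 at \<open>u = 2 / (r + 1)\<close>, because
  \<open>m = (r - 1) * (r + 1) / 4\<close>.\<close>

lemma step_size_condition:
  assumes L: "L > 0" and "0 \<le> \<eta>" and le: "\<eta> \<le> step_upper L m"
  shows "real m * (L * \<eta>)\<^sup>2 \<le> 1 - L * \<eta>"
proof -
  define r where "r = sqrt (1 + 4 * real m)"
  have r: "r \<ge> 1" "real m = (r - 1) * (r + 1) / 4"
    by (auto simp: r_def field_simps simp flip: power2_eq_square)
  have "0 \<le> L * \<eta>"
    using assms by simp
  moreover have "L * \<eta> \<le> 2 / (r + 1)"
    using mult_left_mono[OF le, of L] L by (simp add: step_upper_def r_def[symmetric])
  ultimately have u: "0 \<le> L * \<eta>" "L * \<eta> \<le> 2 / (r + 1)" .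
  have "real m * (L * \<eta>)\<^sup>2 \<le> real m * (2 / (r + 1))\<^sup>2"
    using u by (intro mult_left_mono power_mono) auto
  also have "\<dots> = 1 - 2 / (r + 1)"
    using r(1) by (simp add: r(2) power2_eq_square divide_simps)
  finally show ?thesis
    using u(2) by simp
qed

text \<open>Each \<open>a j\<close> is counted once for every \<open>t\<close> with
  \<open>j < t \<le> m\<close>, hence at most \<open>m\<close> times.\<close>

lemma sum_sum_less_le:
  fixes a :: "nat \<Rightarrow> real"
  assumes "\<And>j. a j \<ge> 0"
  shows "(\<Sum>t\<le>m. \<Sum>j<t. a j) \<le> real m * (\<Sum>j\<le>m. a j)"
proof (induction m)
  case (Suc m)
  have "(\<Sum>t\<le>Suc m. \<Sum>j<t. a j) \<le> (real m + 1) * (\<Sum>j\<le>m. a j)"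
    using Suc by (simp add: lessThan_Suc_atMost algebra_simps)
  also have "\<dots> \<le> real (Suc m) * (\<Sum>j\<le>Suc m. a j)"
    using assms[of "Suc m"] by (auto intro!: mult_mono sum_nonneg assms)
  finally show ?case .
qed simp

section \<open>Regularity of the gradient of the objective and of the stochastic gradients\<close>

context stochastic_problem
begin

text \<open>Unbiasedness turns the difference of gradients into the mean of differences of
  stochastic gradients, each of which obeys the Lipschitz bound.\<close>

lemma grad_objective_lipschitz:
  assumes "smooth_realizations D f L"
  shows "norm (grad (objective D f) u - grad (objective D f) v) \<le> L * norm (u - v)"
proof -
  have "grad (objective D f) u - grad (objective D f) v =
      (\<integral>x. stoch_grad f u x - stoch_grad f v x \<partial>D)"
    using integrable_grad by (simp add: unbiased)
  also have "norm \<dots> \<le> (\<integral>x. norm (stoch_grad f u x - stoch_grad f v x) \<partial>D)"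
    by (rule integral_norm_bound)
  also have "\<dots> \<le> (\<integral>x. L * norm (u - v) \<partial>D)"
    using assms integrable_grad
    by (intro integral_mono) (auto simp: smooth_realizations_def)
  finally show ?thesis
    by (simp add: prob_space)
qed

lemma borel_measurable_stoch_grad:
  assumes "smooth_realizations D f L" "W \<in> borel_measurable N" "X \<in> measurable N D"
  shows "(\<lambda>s. stoch_grad f (W s) (X s)) \<in> borel_measurable N"
proof (rule borel_measurable_Caratheodory[OF assms(2,3)])
  show "stoch_grad f w \<in> borel_measurable D" for w
    using integrable_grad by auto
  fix x assume x: "x \<in> space D"
  \<comment> \<open>\<open>lipschitz_on\<close> demands a nonnegative constant, and the sign of
    \<open>L\<close> is not fixed in this context.\<close>
  have "\<bar>L\<bar>-lipschitz_on UNIV (\<lambda>w. stoch_grad f w x)"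
  proof (rule lipschitz_onI)
    fix u v
    have "dist (stoch_grad f u x) (stoch_grad f v x) \<le> L * dist u v"
      using assms(1) x by (simp add: smooth_realizations_def dist_norm)
    also have "\<dots> \<le> \<bar>L\<bar> * dist u v"
      by (intro mult_right_mono) auto
    finally show "dist (stoch_grad f u x) (stoch_grad f v x) \<le> \<bar>L\<bar> * dist u v" .
  qed simp
  then show "continuous_on UNIV (\<lambda>w. stoch_grad f w x)"
    by (rule lipschitz_on_continuous_on)
qed

end

section \<open>One run as a process on the product space of the samples\<close>

locale sarah_run = stochastic_problem D f
  for D :: "'x measure" and f :: "real ^ 'd \<Rightarrow> 'x \<Rightarrow> real" +
  fixes L \<eta> Fstar :: real and w0 :: "real ^ 'd" and m b :: nat
  assumes L_pos: "L > 0" and \<eta>_pos: "\<eta> > 0" and \<eta>_le: "\<eta> \<le> step_upper L m"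
    and smooth: "smooth_realizations D f L"
    and Fstar_le: "\<And>w. Fstar \<le> objective D f w"
    and integrable_start: "integrable D (\<lambda>x. (norm (stoch_grad f w0 x))\<^sup>2)"
    and b_pos: "b > 0"
begin

abbreviation "P \<equiv> \<Pi>\<^sub>M j\<in>sample_index b. D"
abbreviation "gradF \<equiv> grad (objective D f)"

text \<open>Canonical version of the iterates: the sample point \<open>s\<close> itself supplies the
  data, with \<open>Inl i\<close> holding the initial samples and \<open>Inr i\<close> those of the
  inner loop.\<close>

definition W :: "nat \<Rightarrow> (nat + nat \<Rightarrow> 'x) \<Rightarrow> real ^ 'd" where
  "W t s = isarah_w f w0 \<eta> b (\<lambda>i. s (Inl i)) (\<lambda>i. s (Inr i)) t"

definition V :: "nat \<Rightarrow> (nat + nat \<Rightarrow> 'x) \<Rightarrow> real ^ 'd" where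
  "V t s = isarah_v f w0 \<eta> b (\<lambda>i. s (Inl i)) (\<lambda>i. s (Inr i)) t"

lemma W_0: "W 0 s = w0"
  and W_Suc: "W (Suc t) s = W t s - \<eta> *\<^sub>R V t s"
  and V_0: "V 0 s = (1 / real b) *\<^sub>R (\<Sum>i = 1..b. stoch_grad f w0 (s (Inl i)))"
  and V_Suc: "V (Suc t) s =
    stoch_grad f (W (Suc t) s) (s (Inr (Suc t))) - stoch_grad f (W t s) (s (Inr (Suc t))) + V t s"
  by (simp_all add: W_def V_def)

sublocale P: prob_space P
  by (intro prob_space_PiM) (rule prob_space_axioms)

lemma component_measurable: "j \<in> sample_index b \<Longrightarrow> (\<lambda>s. s j) \<in> measurable P D"
  by (rule measurable_component_singleton)

lemma Inl_sample: "i \<in> {1..b} \<Longrightarrow> Inl i \<in> sample_index b"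
  and Inr_sample: "Inr (Suc t) \<in> sample_index b"
  by (auto simp: sample_index_def)

lemma distr_component: "j \<in> sample_index b \<Longrightarrow> distr P D (\<lambda>s. s j) = D"
  by (rule distr_PiM_component) (rule prob_space_axioms)

lemma W_V_measurable: "W t \<in> borel_measurable P" "V t \<in> borel_measurable P"
proof (induction t)
  case 0
  have W: "W 0 = (\<lambda>s. w0)"
    and V: "V 0 = (\<lambda>s. (1 / real b) *\<^sub>R (\<Sum>i = 1..b. stoch_grad f w0 (s (Inl i))))"
    by (simp_all add: W_0 V_0 fun_eq_iff)
  show "W 0 \<in> borel_measurable P"
    by (simp add: W)
  show "V 0 \<in> borel_measurable P"
    unfolding V
    by (intro borel_measurable_scaleR borel_measurable_const borel_measurable_sum
      borel_measurable_stoch_grad[OF smooth] component_measurable Inl_sample)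
next
  case (Suc t)
  have W: "W (Suc t) = (\<lambda>s. W t s - \<eta> *\<^sub>R V t s)"
    by (rule ext) (rule W_Suc)
  have V: "V (Suc t) = (\<lambda>s. stoch_grad f (W (Suc t) s) (s (Inr (Suc t)))
      - stoch_grad f (W t s) (s (Inr (Suc t))) + V t s)"
    by (rule ext) (rule V_Suc)
  show *: "W (Suc t) \<in> borel_measurable P"
    unfolding W by (intro borel_measurable_scaleR borel_measurable_const borel_measurable_diff Suc)
  show "V (Suc t) \<in> borel_measurable P"
    unfolding V
    by (intro borel_measurable_add borel_measurable_diff borel_measurable_stoch_grad[OF smooth]
      component_measurable Inr_sample Suc *)
qed

text \<open>Adaptedness: up to time \<open>k\<close> the recursion has read only the inner samples 1
  to \<open>k\<close>, so sample \<open>Suc k\<close> can be redrawn freely.\<close>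

lemma W_V_fun_upd:
  assumes "t \<le> k"
  shows "W t (s(Inr (Suc k) := y)) = W t s" and "V t (s(Inr (Suc k) := y)) = V t s"
  using assms
proof (induction t)
  case 0
  {
    case 1
    show ?case by (simp add: W_0)
  next
    case 2
    show ?case by (simp add: V_0)
  }
next
  case (Suc t)
  {
    case 1
    then have "t \<le> k"
      by simp
    then show ?case
      by (simp only: W_Suc Suc.IH)
  } note W = this
  {
    case 2
    then have "t \<le> k" and ne: "Inr (Suc t) \<noteq> (Inr (Suc k) :: nat + nat)"
      by simp_all
    then show ?case
      by (simp only: V_Suc W[OF 2] Suc.IH fun_upd_other[OF ne])
  }
qed

text \<open>The iterate is one index ahead of the estimator: \<open>W (Suc k)\<close> is computed
  from \<open>W k\<close> and \<open>V k\<close>, before sample \<open>Suc k\<close> is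
  read.\<close>

lemma W_fun_upd: "t \<le> Suc k \<Longrightarrow> W t (s(Inr (Suc k) := y)) = W t s"
  by (cases t) (auto simp: W_0 W_Suc W_V_fun_upd)

lemma square_integrable_component:
  assumes "j \<in> sample_index b"
  shows "square_integrable P (\<lambda>s. stoch_grad f w0 (s j))"
    and "(\<integral>s. (norm (stoch_grad f w0 (s j)))\<^sup>2 \<partial>P) = (\<integral>x. (norm (stoch_grad f w0 x))\<^sup>2 \<partial>D)"
proof -
  note meas = component_measurable[OF assms]
  have g: "stoch_grad f w0 \<in> borel_measurable D"
    using integrable_grad by auto
  show "square_integrable P (\<lambda>s. stoch_grad f w0 (s j))"
    unfolding square_integrable_def
    using measurable_compose[OF meas g] integrable_start
      integrable_distr[OF meas, of "\<lambda>x. (norm (stoch_grad f w0 x))\<^sup>2"]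
    by (auto simp: distr_component[OF assms])
  show "(\<integral>s. (norm (stoch_grad f w0 (s j)))\<^sup>2 \<partial>P) = (\<integral>x. (norm (stoch_grad f w0 x))\<^sup>2 \<partial>D)"
    using integral_distr[OF meas, of "\<lambda>x. (norm (stoch_grad f w0 x))\<^sup>2"] g
    by (simp add: distr_component[OF assms])
qed

lemma norm_V_increment_le:
  assumes "s \<in> space P"
  shows "norm (V (Suc t) s - V t s) \<le> (L * \<eta>) * norm (V t s)"
proof -
  have "s (Inr (Suc t)) \<in> space D"
    using component_measurable[OF Inr_sample] assms by (auto dest: measurable_space)
  then have "norm (V (Suc t) s - V t s) \<le> L * norm (W (Suc t) s - W t s)"
    using smooth by (simp add: V_Suc smooth_realizations_def)
  then show ?thesis
    using \<eta>_pos by (simp add: W_Suc)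
qed

text \<open>The finite second moment at \<open>w0\<close> propagates in time, because each increment
  of \<open>V\<close> is at most \<open>L * \<eta>\<close> times the norm of the previous
  \<open>V\<close>.\<close>

lemma square_integrable_V: "square_integrable P (V t)"
proof (induction t)
  case 0
  have "V 0 = (\<lambda>s. (1 / real b) *\<^sub>R (\<Sum>i = 1..b. stoch_grad f w0 (s (Inl i))))"
    by (rule ext) (rule V_0)
  then show ?case
    by (elim ssubst)
      (intro square_integrable_scaleR square_integrable_sum square_integrable_component Inl_sample)
next
  case (Suc t)
  have "square_integrable P (\<lambda>s. V (Suc t) s - V t s)"
    by (intro square_integrable_bound[OF Suc, where C = "L * \<eta>"] norm_V_increment_le borel_measurable_diff
      W_V_measurable)
  from square_integrable_add[OF this Suc] show ?case
    by simp
qed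

lemma square_integrable_W: "square_integrable P (W t)"
proof (induction t)
  case 0
  have "W 0 = (\<lambda>_. w0)"
    by (auto simp: W_0)
  then show ?case
    by (simp add: P.square_integrable_const)
next
  case (Suc t)
  have "W (Suc t) = (\<lambda>s. W t s - \<eta> *\<^sub>R V t s)"
    by (auto simp: W_Suc)
  then show ?case
    using Suc by (simp add: square_integrable_diff square_integrable_scaleR square_integrable_V)
qed

lemma gradF_lipschitz: "norm (gradF u - gradF v) \<le> L * norm (u - v)"
  by (rule grad_objective_lipschitz[OF smooth])

lemma continuous_gradF: "continuous_on UNIV gradF"
proof (rule lipschitz_on_continuous_on)
  show "L-lipschitz_on UNIV gradF"
    using gradF_lipschitz L_pos by (auto intro!: lipschitz_onI simp: dist_norm)
qed

lemma borel_measurable_gradF: "gradF \<in> borel_measurable borel"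
  by (rule borel_measurable_continuous_onI[OF continuous_gradF])

lemma square_integrable_gradF: "square_integrable P (\<lambda>s. gradF (W t s))"
proof -
  have meas: "(\<lambda>s. gradF (W t s)) \<in> borel_measurable P"
    by (rule measurable_compose[OF W_V_measurable(1) borel_measurable_gradF])
  have "square_integrable P (\<lambda>s. W t s - w0)"
    by (intro square_integrable_diff square_integrable_W P.square_integrable_const)
  then have "square_integrable P (\<lambda>s. gradF (W t s) - gradF w0)"
    by (rule square_integrable_bound[where C = L])
      (intro borel_measurable_diff borel_measurable_const meas gradF_lipschitz)+
  from square_integrable_add[OF this P.square_integrable_const[of "gradF w0"]] show ?thesis
    by simp
qed

section \<open>The second moment of the estimation error\<close>

definition error :: "nat \<Rightarrow> (nat + nat \<Rightarrow> 'x) \<Rightarrow> real ^ 'd" where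
  "error t s = V t s - gradF (W t s)"

lemma square_integrable_error: "square_integrable P (error t)"
  unfolding error_def[abs_def]
  by (intro square_integrable_diff square_integrable_V square_integrable_gradF)

abbreviation "G \<equiv> \<integral>x. (norm (stoch_grad f w0 x))\<^sup>2 \<partial>D"

text \<open>The centered gradients are added one at a time, each being centered with respect to its
  own coordinate. Every summand therefore contributes at most \<open>G\<close> to the second moment
  of the partial sum \<open>S k\<close>, and \<open>b * G / b^2 = G / b\<close>.\<close>

lemma second_moment_error_0: "(\<integral>s. (norm (error 0 s))\<^sup>2 \<partial>P) \<le> G / real b"
proof -
  define S where "S k s = (\<Sum>i = 1..k. stoch_grad f w0 (s (Inl i)) - gradF w0)"
    for k :: nat and s :: "nat + nat \<Rightarrow> 'x"
  have S_sq: "square_integrable P (S k)" if "k \<le> b" for k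
    unfolding S_def[abs_def] using that
    by (intro square_integrable_sum square_integrable_diff square_integrable_component
      P.square_integrable_const Inl_sample) auto
  have "(\<integral>s. (norm (S k s))\<^sup>2 \<partial>P) \<le> real k * G" if "k \<le> b" for k
    using that
  proof (induction k)
    case 0
    then show ?case
      by (simp add: S_def)
  next
    case (Suc k)
    then have j: "Inl (Suc k) \<in> sample_index b"
      by (intro Inl_sample) auto
    have "(\<integral>s. (norm (S (Suc k) s))\<^sup>2 \<partial>P) =
        (\<integral>s. (norm (S k s + (stoch_grad f w0 (s (Inl (Suc k))) - gradF w0)))\<^sup>2 \<partial>P)"
      by (simp add: S_def)
    also have "\<dots> \<le> (\<integral>s. (norm (S k s))\<^sup>2 \<partial>P) + (\<integral>s. (norm (stoch_grad f w0 (s (Inl (Suc k)))))\<^sup>2 \<partial>P)"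
      using Suc.prems
      by (intro second_moment_add_centered_le[OF j] S_sq square_integrable_component[OF j]
          P.square_integrable_const)
        (auto simp: S_def unbiased integrable_grad)
    also have "\<dots> \<le> real k * G + G"
      using Suc by (simp add: square_integrable_component[OF j])
    finally show ?case
      by (simp add: algebra_simps)
  qed
  from this[of b] have "(\<integral>s. (norm (S b s))\<^sup>2 \<partial>P) / (real b)\<^sup>2 \<le> real b * G / (real b)\<^sup>2"
    by (intro divide_right_mono) auto
  moreover have "error 0 s = (1 / real b) *\<^sub>R S b s" for s
    using b_pos by (simp add: error_def S_def V_0 W_0 sum_subtractf sum_constant_scaleR scaleR_diff_right
      del: sum_constant)
  ultimately show ?thesis
    using b_pos by (simp add: power_divide power2_eq_square)
qed

lemma second_moment_error_Suc:
  "(\<integral>s. (norm (error (Suc t) s))\<^sup>2 \<partial>P) \<le>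
    (\<integral>s. (norm (error t s))\<^sup>2 \<partial>P) + (L * \<eta>)\<^sup>2 * (\<integral>s. (norm (V t s))\<^sup>2 \<partial>P)"
proof -
  let ?X = "\<lambda>s. V (Suc t) s - V t s"
  \<comment> \<open>\<open>?C\<close> is the mean of the increment \<open>?X\<close> over the fresh
    sample \<open>Inr (Suc t)\<close>. Neither \<open>?C\<close> nor \<open>error t\<close> depends
    on that coordinate, so \<open>second_moment_add_centered_le\<close> applies.\<close>
  let ?C = "\<lambda>s. gradF (W (Suc t) s) - gradF (W t s)"
  have sq: "square_integrable P ?X"
    by (intro square_integrable_diff square_integrable_V)
  have "(\<integral>s. (norm (error (Suc t) s))\<^sup>2 \<partial>P) = (\<integral>s. (norm (error t s + (?X s - ?C s)))\<^sup>2 \<partial>P)"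
    by (simp add: error_def)
  also have "\<dots> \<le> (\<integral>s. (norm (error t s))\<^sup>2 \<partial>P) + (\<integral>s. (norm (?X s))\<^sup>2 \<partial>P)"
    by (intro second_moment_add_centered_le[OF Inr_sample[of t]] square_integrable_error sq
        square_integrable_diff square_integrable_gradF)
      (simp_all add: error_def V_Suc W_V_fun_upd W_fun_upd integrable_grad unbiased)
  also have "(\<integral>s. (norm (?X s))\<^sup>2 \<partial>P) \<le> (\<integral>s. (L * \<eta>)\<^sup>2 * (norm (V t s))\<^sup>2 \<partial>P)"
  proof (rule integral_mono)
    fix s assume "s \<in> space P"
    from power_mono[OF norm_V_increment_le[OF this, of t], of 2]
    show "(norm (?X s))\<^sup>2 \<le> (L * \<eta>)\<^sup>2 * (norm (V t s))\<^sup>2"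
      by (simp add: power_mult_distrib)
  qed (use sq square_integrable_V[of t] in \<open>auto simp: square_integrable_def\<close>)
  finally show ?thesis
    by simp
qed

lemma second_moment_error:
  "(\<integral>s. (norm (error t s))\<^sup>2 \<partial>P) \<le>
    G / real b + (L * \<eta>)\<^sup>2 * (\<Sum>j<t. \<integral>s. (norm (V j s))\<^sup>2 \<partial>P)"
proof (induction t)
  case 0
  then show ?case
    using second_moment_error_0 by simp
next
  case (Suc t)
  then show ?case
    using second_moment_error_Suc[of t] by (simp add: algebra_simps)
qed

section \<open>Descent along a path and summation in expectation\<close>

lemma objective_W_Suc:
  "objective D f (W (Suc t) s) \<le> objective D f (W t s) - \<eta> / 2 * (norm (gradF (W t s)))\<^sup>2
    + \<eta> / 2 * (norm (error t s))\<^sup>2 - \<eta> / 2 * ((1 - L * \<eta>) * (norm (V t s))\<^sup>2)"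
proof -
  have "objective D f (W t s + (- \<eta>) *\<^sub>R V t s) \<le> objective D f (W t s)
      + gradF (W t s) \<bullet> ((- \<eta>) *\<^sub>R V t s) + L / 2 * (norm ((- \<eta>) *\<^sub>R V t s))\<^sup>2"
    by (rule descent_lemma[OF differentiable_objective gradF_lipschitz])
  then have "objective D f (W (Suc t) s) \<le> objective D f (W t s)
      - \<eta> * (gradF (W t s) \<bullet> V t s) + L / 2 * (\<eta>\<^sup>2 * (norm (V t s))\<^sup>2)"
    by (simp add: W_Suc power_mult_distrib)
  \<comment> \<open>Polarization. The resulting term \<open>- \<eta> / 2\<close> times the squared
    norm of \<open>V t s\<close> combines with the smoothness term \<open>L * \<eta>^2 / 2\<close>
    into the factor \<open>1 - L * \<eta>\<close>.\<close>
  moreover have "gradF (W t s) \<bullet> V t s =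
      ((norm (V t s))\<^sup>2 + (norm (gradF (W t s)))\<^sup>2 - (norm (error t s))\<^sup>2) / 2"
    by (simp add: error_def power2_norm_eq_inner inner_diff inner_commute)
  ultimately show ?thesis
    by (simp add: field_simps power2_eq_square[of \<eta>])
qed

text \<open>Telescoping of the one-step descent, still along a fixed sample path.\<close>

lemma sum_norm_gradF_le:
  "\<eta> / 2 * (\<Sum>t\<le>n. (norm (gradF (W t s)))\<^sup>2) \<le> objective D f w0 - objective D f (W (Suc n) s)
    + \<eta> / 2 * (\<Sum>t\<le>n. (norm (error t s))\<^sup>2 - (1 - L * \<eta>) * (norm (V t s))\<^sup>2)"
proof (induction n)
  case 0
  then show ?case
    using objective_W_Suc[of 0 s] by (simp add: W_0 algebra_simps diff_divide_distrib)
next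
  case (Suc n)
  then show ?case
    using objective_W_Suc[of "Suc n" s]
    unfolding sum.atMost_Suc distrib_left right_diff_distrib by linarith
qed

lemma sum_second_moment_gradF:
  "(\<Sum>t\<le>m. \<integral>s. (norm (gradF (W t s)))\<^sup>2 \<partial>P) \<le>
    2 * (objective D f w0 - Fstar) / \<eta> + (real m + 1) * (G / real b)"
proof -
  define e v where "e t = (\<integral>s. (norm (error t s))\<^sup>2 \<partial>P)" and "v t = (\<integral>s. (norm (V t s))\<^sup>2 \<partial>P)" for t
  note [simp] = square_integrable_gradF[unfolded square_integrable_def, THEN conjunct2]
    square_integrable_error[unfolded square_integrable_def, THEN conjunct2]
    square_integrable_V[unfolded square_integrable_def, THEN conjunct2]
  \<comment> \<open>\<open>Fstar\<close> replaces the final objective value pathwise, so only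
    squared norms have to be integrated.\<close>
  let ?R = "\<lambda>s. 2 * (objective D f w0 - Fstar) / \<eta>
    + (\<Sum>t\<le>m. (norm (error t s))\<^sup>2 - (1 - L * \<eta>) * (norm (V t s))\<^sup>2)"
  have "(\<Sum>t\<le>m. \<integral>s. (norm (gradF (W t s)))\<^sup>2 \<partial>P) = (\<integral>s. (\<Sum>t\<le>m. (norm (gradF (W t s)))\<^sup>2) \<partial>P)"
    by simp
  also have "\<dots> \<le> (\<integral>s. ?R s \<partial>P)"
  proof (rule integral_mono)
    fix s
    have "\<eta> / 2 * (\<Sum>t\<le>m. (norm (gradF (W t s)))\<^sup>2) \<le> \<eta> / 2 * ?R s"
    proof -
      have "\<eta> / 2 * (2 * (objective D f w0 - Fstar) / \<eta>) = objective D f w0 - Fstar"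
        using \<eta>_pos by simp
      then show ?thesis
        using sum_norm_gradF_le[of s m] Fstar_le[of "W (Suc m) s"] unfolding distrib_left by linarith
    qed
    then show "(\<Sum>t\<le>m. (norm (gradF (W t s)))\<^sup>2) \<le> ?R s"
      using \<eta>_pos by simp
  qed auto
  also have "\<dots> = 2 * (objective D f w0 - Fstar) / \<eta> + ((\<Sum>t\<le>m. e t) - (1 - L * \<eta>) * (\<Sum>t\<le>m. v t))"
    by (simp add: P.prob_space e_def v_def sum_subtractf sum_distrib_left)
  also have "(\<Sum>t\<le>m. e t) \<le> (\<Sum>t\<le>m. G / real b + (L * \<eta>)\<^sup>2 * (\<Sum>j<t. v j))"
    unfolding e_def v_def by (intro sum_mono second_moment_error)
  also have "\<dots> = (real m + 1) * (G / real b) + (L * \<eta>)\<^sup>2 * (\<Sum>t\<le>m. \<Sum>j<t. v j)"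
    by (simp add: sum.distrib sum_distrib_left)
  also have "(L * \<eta>)\<^sup>2 * (\<Sum>t\<le>m. \<Sum>j<t. v j) \<le> (L * \<eta>)\<^sup>2 * (real m * (\<Sum>t\<le>m. v t))"
    by (intro mult_left_mono sum_sum_less_le) (auto simp: v_def)
  \<comment> \<open>The step size condition enters here: the accumulated error is absorbed by the
    negative term in \<open>v\<close>.\<close>
  also have "\<dots> \<le> (1 - L * \<eta>) * (\<Sum>t\<le>m. v t)"
    using mult_right_mono[OF step_size_condition[OF L_pos _ \<eta>_le], of "\<Sum>t\<le>m. v t"] \<eta>_pos
    by (simp add: v_def sum_nonneg mult_ac)
  finally show ?thesis
    by simp
qed

end

subsection \<open>The random output\<close>

text \<open>The recursion reads only \<open>z 1\<close> to \<open>z b\<close> and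
  \<open>x 1\<close>, \<open>x 2\<close> and so on. This permits replacing the samples by their
  restriction to \<open>sample_index b\<close>.\<close>

lemma isarah_cong:
  assumes "\<And>i. i \<in> {1..b} \<Longrightarrow> z i = z' i" and "\<And>i. x (Suc i) = x' (Suc i)"
  shows "isarah_w f w0 \<eta> b z x t = isarah_w f w0 \<eta> b z' x' t"
    and "isarah_v f w0 \<eta> b z x t = isarah_v f w0 \<eta> b z' x' t"
  by (induction t) (simp_all add: assms)

context isarah_randomness
begin

text \<open>The restriction yields a point of the product space; it is the map whose preimages occur
  in \<open>index_indep\<close>.\<close>

definition samples :: "'w \<Rightarrow> nat + nat \<Rightarrow> 'x" where
  "samples \<omega> = (\<lambda>j\<in>sample_index b. case_sum \<zeta> \<xi> j \<omega>)"

lemma measurable_sample: "j \<in> sample_index b \<Longrightarrow> case_sum \<zeta> \<xi> j \<in> measurable M D"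
  using samples_indep unfolding indep_vars_def by blast

lemma measurable_samples: "samples \<in> measurable M (\<Pi>\<^sub>M j\<in>sample_index b. D)"
  unfolding samples_def[abs_def] by (intro measurable_restrict measurable_sample)

text \<open>Independence makes the joint law the product of the marginals, all equal to
  \<open>D\<close>. Expectations computed on the product space thus carry over to
  \<open>M\<close>.\<close>

lemma distr_samples: "distr M (\<Pi>\<^sub>M j\<in>sample_index b. D) samples = (\<Pi>\<^sub>M j\<in>sample_index b. D)"
proof -
  have "sample_index b \<noteq> {}"
    by (auto simp: sample_index_def)
  then have "distr M (\<Pi>\<^sub>M j\<in>sample_index b. D) samples =
      (\<Pi>\<^sub>M j\<in>sample_index b. distr M D (case_sum \<zeta> \<xi> j))"
    using samples_indep measurable_sample unfolding samples_def[abs_def]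
    by (intro iffD1[OF indep_vars_iff_distr_eq_PiM'])
  also have "\<dots> = (\<Pi>\<^sub>M j\<in>sample_index b. D)"
    by (intro PiM_cong refl samples_law)
  finally show ?thesis .
qed

lemma prob_index:
  assumes "t \<le> m"
  shows "prob (T -` {t} \<inter> space M) = 1 / (real m + 1)"
proof -
  have "prob (T -` {t} \<inter> space M) = measure (distr M (count_space UNIV) T) {t}"
    by (rule measure_distr[symmetric]) (use index_measurable in auto)
  also have "\<dots> = 1 / (real m + 1)"
    using assms by (simp add: index_law measure_pmf_single)
  finally show ?thesis .
qed

text \<open>\<open>T\<close> is constrained through its law alone, so the bound can fail on a null
  set.\<close>

lemma AE_index_le: "AE \<omega> in M. T \<omega> \<le> m"
proof -
  have "AE t in measure_pmf (pmf_of_set {0..m}). t \<le> m"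
    by (subst AE_measure_pmf_iff) simp
  then have "AE t in distr M (count_space UNIV) T. t \<le> m"
    unfolding index_law .
  then show ?thesis
    by (subst (asm) AE_distr_iff) (use index_measurable in auto)
qed

text \<open>Replacing \<open>T\<close> by the real indicator of \<open>T = t\<close> gives two real
  random variables, to which the product rule for expectations applies. Their preimages belong to
  the two families in \<open>index_indep\<close>.\<close>

lemma indep_index_samples:
  fixes g :: "(nat + nat \<Rightarrow> 'x) \<Rightarrow> real"
  assumes g: "g \<in> borel_measurable (\<Pi>\<^sub>M j\<in>sample_index b. D)"
  shows "indep_var borel (indicator (T -` {t} \<inter> space M)) borel (\<lambda>\<omega>. g (samples \<omega>))"
  unfolding indep_var_def indep_vars_def2
proof (intro conjI ballI)
  have I: "(indicator (T -` {t} \<inter> space M) :: _ \<Rightarrow> real) \<in> borel_measurable M"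
    using measurable_sets[OF index_measurable, of "{t}"] by simp
  have G: "(\<lambda>\<omega>. g (samples \<omega>)) \<in> borel_measurable M"
    by (rule measurable_compose[OF measurable_samples g])
  show "case_bool (indicator (T -` {t} \<inter> space M)) (\<lambda>\<omega>. g (samples \<omega>)) i
      \<in> measurable M (case_bool borel borel i)" for i
    using I G by (cases i) auto
  show "indep_sets (\<lambda>i. {case_bool (indicator (T -` {t} \<inter> space M)) (\<lambda>\<omega>. g (samples \<omega>)) i -` A \<inter> space M |
      A. A \<in> sets (case_bool borel borel i)}) UNIV"
  proof (rule indep_sets_mono_sets[OF index_indep[unfolded indep_set_def]])
    fix i :: bool
    have I_eq: "(indicator (T -` {t} \<inter> space M) :: _ \<Rightarrow> real) -` A \<inter> space M =
        T -` {n. indicator {t} n \<in> A} \<inter> space M" for A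
      by (auto simp: indicator_def)
    have G_eq: "(\<lambda>\<omega>. g (samples \<omega>)) -` A \<inter> space M =
        samples -` (g -` A \<inter> space (\<Pi>\<^sub>M j\<in>sample_index b. D)) \<inter> space M" for A
      using measurable_space[OF measurable_samples] by blast
    show "{case_bool (indicator (T -` {t} \<inter> space M)) (\<lambda>\<omega>. g (samples \<omega>)) i -` A \<inter> space M |
        A. A \<in> sets (case_bool borel borel i)} \<subseteq>
      (case i of True \<Rightarrow> {T -` A \<inter> space M |A. True}
       | False \<Rightarrow> {(\<lambda>\<omega>. \<lambda>j\<in>sample_index b. case_sum \<zeta> \<xi> j \<omega>) -` B \<inter> space M |B.
           B \<in> sets (\<Pi>\<^sub>M j\<in>sample_index b. D)})"
    proof (induction i)
      case True
      show ?case
        unfolding bool.case I_eq by blast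
    next
      case False
      show ?case
        unfolding bool.case G_eq samples_def[abs_def, symmetric]
        using measurable_sets[OF g] by blast
    qed
  qed
qed

text \<open>Almost surely the value at the random index is the sum over \<open>t \<le> m\<close> of
  the indicator of \<open>T = t\<close> times \<open>h t\<close>. Independence factors each
  expectation, and each index has probability \<open>1 / (m + 1)\<close>.\<close>

lemma integral_random_index:
  fixes h :: "nat \<Rightarrow> (nat + nat \<Rightarrow> 'x) \<Rightarrow> real"
  assumes h: "\<And>t. integrable (\<Pi>\<^sub>M j\<in>sample_index b. D) (h t)"
  shows "integrable M (\<lambda>\<omega>. h (T \<omega>) (samples \<omega>))"
    and "(\<integral>\<omega>. h (T \<omega>) (samples \<omega>) \<partial>M) =
      (\<Sum>t\<le>m. \<integral>s. h t s \<partial>(\<Pi>\<^sub>M j\<in>sample_index b. D)) / (real m + 1)"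
proof -
  let ?P = "\<Pi>\<^sub>M j\<in>sample_index b. D"
  let ?I = "\<lambda>t. indicator (T -` {t} \<inter> space M) :: 'w \<Rightarrow> real"
  have h_meas: "h t \<in> borel_measurable ?P" for t
    using h by auto
  have h_M: "integrable M (\<lambda>\<omega>. h t (samples \<omega>))" for t
    by (rule integrable_distr[OF measurable_samples]) (simp add: distr_samples h)
  have h_int: "(\<integral>\<omega>. h t (samples \<omega>) \<partial>M) = (\<integral>s. h t s \<partial>?P)" for t
    using integral_distr[OF measurable_samples h_meas, of t] by (simp add: distr_samples)
  have T_sets: "T -` {t} \<inter> space M \<in> events" for t
    using measurable_sets[OF index_measurable, of "{t}"] by simp
  then have I: "integrable M (?I t)" "(\<integral>\<omega>. ?I t \<omega> \<partial>M) = prob (T -` {t} \<inter> space M)" for t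
    by (auto simp: less_top[symmetric])
  note indep = indep_index_samples[OF h_meas]
  have prod_int: "integrable M (\<lambda>\<omega>. ?I t \<omega> * h t (samples \<omega>))" for t
    by (rule indep_var_integrable[OF indep I(1) h_M])
  have prod_eq: "(\<integral>\<omega>. ?I t \<omega> * h t (samples \<omega>) \<partial>M) = prob (T -` {t} \<inter> space M) * (\<integral>s. h t s \<partial>?P)" for t
    using indep_var_lebesgue_integral[OF indep I(1) h_M] by (simp only: I h_int)
  have meas: "(\<lambda>\<omega>. h (T \<omega>) (samples \<omega>)) \<in> borel_measurable M"
    by (rule measurable_compose_countable[where f = "\<lambda>t \<omega>. h t (samples \<omega>)"])
      (auto intro: measurable_compose[OF measurable_samples h_meas] index_measurable)
  have ae: "AE \<omega> in M. (\<Sum>t\<le>m. ?I t \<omega> * h t (samples \<omega>)) = h (T \<omega>) (samples \<omega>)"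
    using AE_index_le AE_space
  proof eventually_elim
    case (elim \<omega>)
    have "(\<Sum>t\<le>m. ?I t \<omega> * h t (samples \<omega>)) = (\<Sum>t\<le>m. if t = T \<omega> then h t (samples \<omega>) else 0)"
      using elim by (intro sum.cong) (auto simp: indicator_def)
    then show ?case
      using elim by (simp add: sum.delta)
  qed
  have sum_int: "integrable M (\<lambda>\<omega>. \<Sum>t\<le>m. ?I t \<omega> * h t (samples \<omega>))"
    by (intro Bochner_Integration.integrable_sum prod_int)
  show "integrable M (\<lambda>\<omega>. h (T \<omega>) (samples \<omega>))"
    by (rule integrable_cong_AE_imp[OF sum_int meas]) (use ae in \<open>auto simp: eq_commute\<close>)
  have "(\<integral>\<omega>. h (T \<omega>) (samples \<omega>) \<partial>M) = (\<integral>\<omega>. (\<Sum>t\<le>m. ?I t \<omega> * h t (samples \<omega>)) \<partial>M)"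
    by (rule integral_cong_AE[symmetric, OF borel_measurable_integrable[OF sum_int] meas ae])
  also have "\<dots> = (\<Sum>t\<le>m. \<integral>\<omega>. ?I t \<omega> * h t (samples \<omega>) \<partial>M)"
    by (rule Bochner_Integration.integral_sum) (rule prod_int)
  also have "\<dots> = (\<Sum>t\<le>m. (\<integral>s. h t s \<partial>?P) / (real m + 1))"
    by (intro sum.cong) (simp_all add: prod_eq prob_index)
  finally show "(\<integral>\<omega>. h (T \<omega>) (samples \<omega>) \<partial>M) = (\<Sum>t\<le>m. \<integral>s. h t s \<partial>?P) / (real m + 1)"
    by (simp add: sum_divide_distrib)
qed

end

lemma (in sarah_run) output_second_moment:
  fixes M :: "'w measure"
  assumes "isarah_randomness M D m b \<zeta> \<xi> T"
  shows "integrable M (\<lambda>\<omega>. (norm (gradF (isarah_output f w0 \<eta> b \<zeta> \<xi> T \<omega>)))\<^sup>2)"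
    and "(\<integral>\<omega>. (norm (gradF (isarah_output f w0 \<eta> b \<zeta> \<xi> T \<omega>)))\<^sup>2 \<partial>M) \<le>
      2 * (objective D f w0 - Fstar) / (\<eta> * (real m + 1)) + G / real b"
proof -
  interpret R: isarah_randomness M D m b \<zeta> \<xi> T by fact
  have out: "isarah_output f w0 \<eta> b \<zeta> \<xi> T = (\<lambda>\<omega>. W (T \<omega>) (R.samples \<omega>))"
    unfolding isarah_output_def[abs_def] W_def R.samples_def
    by (intro ext isarah_cong) (auto simp: sample_index_def)
  have int: "integrable P (\<lambda>s. (norm (gradF (W t s)))\<^sup>2)" for t
    using square_integrable_gradF[of t] by (simp add: square_integrable_def)
  note random_index = R.integral_random_index[where h = "\<lambda>t s. (norm (gradF (W t s)))\<^sup>2", OF int]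
  show "integrable M (\<lambda>\<omega>. (norm (gradF (isarah_output f w0 \<eta> b \<zeta> \<xi> T \<omega>)))\<^sup>2)"
    unfolding out by (rule random_index)
  have "(\<integral>\<omega>. (norm (gradF (isarah_output f w0 \<eta> b \<zeta> \<xi> T \<omega>)))\<^sup>2 \<partial>M) =
      (\<Sum>t\<le>m. \<integral>s. (norm (gradF (W t s)))\<^sup>2 \<partial>P) / (real m + 1)"
    unfolding out by (rule random_index)
  also have "\<dots> \<le> (2 * (objective D f w0 - Fstar) / \<eta> + (real m + 1) * (G / real b)) / (real m + 1)"
    by (intro divide_right_mono sum_second_moment_gradF) simp
  also have "\<dots> = 2 * (objective D f w0 - Fstar) / (\<eta> * (real m + 1)) + G / real b"
    by (simp add: add_divide_distrib)
  finally show "(\<integral>\<omega>. (norm (gradF (isarah_output f w0 \<eta> b \<zeta> \<xi> T \<omega>)))\<^sup>2 \<partial>M) \<le>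
      2 * (objective D f w0 - Fstar) / (\<eta> * (real m + 1)) + G / real b" .
qed

section \<open>Convergence rate and complexity\<close>

text \<open>Since \<open>b^2 = m + 1\<close>, the lower bound \<open>c / (L * b)\<close> on
  \<open>\<eta>\<close> gives \<open>\<eta> * (m + 1) \<ge> c * b / L\<close>. Both terms of
  \<open>output_second_moment\<close> are then of order \<open>1 / b\<close>.\<close>

lemma isarah_rate:
  fixes f :: "real ^ 'd \<Rightarrow> 'x \<Rightarrow> real" and M :: "'w measure"
  assumes L: "L > 0" and c: "c > 0"
    and problem: "stochastic_problem D f" and smooth: "smooth_realizations D f L"
    and Fstar: "\<And>w. Fstar \<le> objective D f w"
    and start: "integrable D (\<lambda>x. (norm (stoch_grad f w0 x))\<^sup>2)"
    and b: "real b = sqrt (real m + 1)"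
    and step: "step_lower L c m \<le> \<eta>" "\<eta> \<le> step_upper L m"
    and random: "isarah_randomness M D m b \<zeta> \<xi> T"
  shows "integrable M (\<lambda>\<omega>. (norm (grad (objective D f) (isarah_output f w0 \<eta> b \<zeta> \<xi> T \<omega>)))\<^sup>2)"
    and "(\<integral>\<omega>. (norm (grad (objective D f) (isarah_output f w0 \<eta> b \<zeta> \<xi> T \<omega>)))\<^sup>2 \<partial>M) \<le>
      (2 * (objective D f w0 - Fstar) * L / c + (\<integral>x. (norm (stoch_grad f w0 x))\<^sup>2 \<partial>D)) / real b"
proof -
  have b_pos: "real b > 0"
    by (simp add: b)
  have b2: "real m + 1 = (real b)\<^sup>2"
    by (simp add: b)
  have lower: "c / (L * real b) \<le> \<eta>"
    using step(1) by (simp add: step_lower_def b)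
  moreover have "0 < c / (L * real b)"
    using L c b_pos by simp
  ultimately have \<eta>: "\<eta> > 0"
    by linarith
  interpret stochastic_problem D f by fact
  interpret sarah_run D f L \<eta> Fstar w0 m b
    by unfold_locales (use L \<eta> step smooth Fstar start b_pos in auto)
  show "integrable M (\<lambda>\<omega>. (norm (gradF (isarah_output f w0 \<eta> b \<zeta> \<xi> T \<omega>)))\<^sup>2)"
    by (rule output_second_moment[OF random])
  have "2 * (objective D f w0 - Fstar) / (\<eta> * (real m + 1)) \<le>
      2 * (objective D f w0 - Fstar) / (c / (L * real b) * (real m + 1))"
    using L c b_pos Fstar[of w0] lower \<eta>
    by (intro divide_left_mono mult_right_mono mult_pos_pos) auto
  also have "\<dots> = 2 * (objective D f w0 - Fstar) * L / c / real b"
    using L c b_pos unfolding b2 by (simp add: power2_eq_square)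
  finally show "(\<integral>\<omega>. (norm (gradF (isarah_output f w0 \<eta> b \<zeta> \<xi> T \<omega>)))\<^sup>2 \<partial>M) \<le>
      (2 * (objective D f w0 - Fstar) * L / c + G) / real b"
    using output_second_moment(2)[OF random] by (simp add: add_divide_distrib)
qed

lemma exists_batch_size:
  fixes K \<epsilon> :: real
  assumes "K \<ge> 0" "0 < \<epsilon>" "\<epsilon> < 1"
  shows "\<exists>m b. 0 < m \<and> N \<le> m \<and> real b = sqrt (real m + 1) \<and> K / real b \<le> \<epsilon> \<and>
    real (total_complexity m b) \<le> 3 * (K + real N + 3)\<^sup>2 * (1 / \<epsilon>\<^sup>2)"
proof -
  \<comment> \<open>The first summand secures the accuracy, \<open>N\<close> secures
    \<open>N \<le> m\<close>, and 2 secures \<open>0 < m\<close> and \<open>b \<le> m\<close>, hence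
    \<open>b + 2 * m \<le> 3 * b^2\<close>.\<close>
  define b where "b = nat \<lceil>K / \<epsilon>\<rceil> + N + 2"
  define m where "m = b\<^sup>2 - 1"
  have "b * 2 \<le> b * b"
    by (intro mult_left_mono) (auto simp: b_def)
  then have m: "m + 1 = b\<^sup>2" "b \<le> m"
    unfolding m_def power2_eq_square by (auto simp: b_def)
  have "real m + 1 = (real b)\<^sup>2"
    using m(1) by (metis of_nat_1 of_nat_add of_nat_power)
  then have b_sqrt: "real b = sqrt (real m + 1)"
    by simp
  have b_pos: "real b > 0"
    by (simp add: b_def)
  have "K / \<epsilon> \<le> real b"
    unfolding b_def using assms by linarith
  then have "K / real b \<le> \<epsilon>"
    using assms b_pos by (simp add: pos_divide_le_eq mult.commute)
  moreover have "real b \<le> (K + real N + 3) / \<epsilon>"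
  proof -
    \<comment> \<open>Rounding up costs at most 1, which turns the summand 2 into 3. Dividing the
      constant part by \<open>\<epsilon> < 1\<close> only enlarges it.\<close>
    have "real b \<le> K / \<epsilon> + (real N + 3)"
      unfolding b_def using assms by (simp add: of_nat_nat) linarith
    also have "real N + 3 \<le> (real N + 3) / \<epsilon>"
      using assms mult_left_le[of \<epsilon> "real N + 3"] by (simp add: pos_le_divide_eq)
    finally show ?thesis
      by (simp add: add_divide_distrib)
  qed
  then have "(real b)\<^sup>2 \<le> ((K + real N + 3) / \<epsilon>)\<^sup>2"
    by (intro power_mono) auto
  moreover have "real (total_complexity m b) \<le> 3 * (real b)\<^sup>2"
  proof -
    have "total_complexity m b \<le> 3 * b\<^sup>2"
      using m by (simp add: total_complexity_def)
    then show ?thesis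
      by (metis of_nat_le_iff of_nat_mult of_nat_numeral of_nat_power)
  qed
  ultimately show ?thesis
    using m(2) b_sqrt by (intro exI[of _ m] exI[of _ b]) (auto simp: power_divide b_def)
qed

text \<open>The constants are chosen from \<open>L\<close>, \<open>c\<close>,
  \<open>\<Delta>\<close> and \<open>G\<close> before the problem, \<open>m\<close> and
  \<open>\<epsilon>\<close>, which renders the dependence allowed in the O-notation. The complexity
  claim presupposes that the interval for \<open>\<eta>\<close> is nonempty for all large
  \<open>m\<close>.\<close>

theorem corollary3:
  fixes L c \<Delta> G :: real
  assumes "L > 0" and "c > 0"
  shows "\<exists>K K' \<epsilon>\<^sub>0 :: real. \<epsilon>\<^sub>0 > 0 \<and>
    (\<forall>(D :: 'x measure) (f :: real ^ 'd \<Rightarrow> 'x \<Rightarrow> real) Fstar w0.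
       stochastic_problem D f \<longrightarrow>
       smooth_realizations D f L \<longrightarrow>
       (\<forall>w. Fstar \<le> objective D f w) \<longrightarrow>
       objective D f w0 - Fstar = \<Delta> \<longrightarrow>
       integrable D (\<lambda>x. (norm (stoch_grad f w0 x))\<^sup>2) \<longrightarrow>
       (\<integral>x. (norm (stoch_grad f w0 x))\<^sup>2 \<partial>D) = G \<longrightarrow>
       (\<forall>m b \<eta> (M :: 'w measure) \<zeta> \<xi> T.
          0 < m \<longrightarrow> real b = sqrt (real m + 1) \<longrightarrow>
          step_lower L c m \<le> \<eta> \<longrightarrow> \<eta> \<le> step_upper L m \<longrightarrow>
          isarah_randomness M D m b \<zeta> \<xi> T \<longrightarrow>
          integrable M (\<lambda>\<omega>. (norm (grad (objective D f) (isarah_output f w0 \<eta> b \<zeta> \<xi> T \<omega>)))\<^sup>2) \<and>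
          (\<integral>\<omega>. (norm (grad (objective D f) (isarah_output f w0 \<eta> b \<zeta> \<xi> T \<omega>)))\<^sup>2 \<partial>M)
            \<le> K * sqrt (1 / (real m + 1))) \<and>
       ((\<forall>\<^sub>F m in sequentially. step_lower L c m \<le> step_upper L m) \<longrightarrow>
        (\<forall>\<epsilon>. 0 < \<epsilon> \<and> \<epsilon> < \<epsilon>\<^sub>0 \<longrightarrow>
          (\<exists>m b. 0 < m \<and> real b = sqrt (real m + 1) \<and>
             step_lower L c m \<le> step_upper L m \<and>
             (\<forall>\<eta> (M :: 'w measure) \<zeta> \<xi> T.
                step_lower L c m \<le> \<eta> \<longrightarrow> \<eta> \<le> step_upper L m \<longrightarrow>
                isarah_randomness M D m b \<zeta> \<xi> T \<longrightarrow>
                integrable M (\<lambda>\<omega>. (norm (grad (objective D f) (isarah_output f w0 \<eta> b \<zeta> \<xi> T \<omega>)))\<^sup>2) \<and>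
                (\<integral>\<omega>. (norm (grad (objective D f) (isarah_output f w0 \<eta> b \<zeta> \<xi> T \<omega>)))\<^sup>2 \<partial>M) \<le> \<epsilon>) \<and>
             real (total_complexity m b) \<le> K' * (1 / \<epsilon>\<^sup>2)))))"
proof -
  define K where "K = 2 * \<Delta> * L / c + G"
  \<comment> \<open>The bound \<open>K'\<close> involves \<open>N\<close> and must be fixed before
    the premise on the step interval is assumed. The premise therefore stays inside the property
    defining \<open>N\<close>, which depends on \<open>L\<close> and \<open>c\<close> only.\<close>
  obtain N where N: "(\<forall>\<^sub>F m in sequentially. step_lower L c m \<le> step_upper L m) \<longrightarrow>
      (\<forall>m\<ge>N. step_lower L c m \<le> step_upper L m)"
    unfolding eventually_sequentially by blast
  show ?thesis
  proof (rule exI[of _ K], rule exI[of _ "3 * (K + real N + 3)\<^sup>2"], rule exI[of _ 1],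
      intro conjI allI impI, goal_cases)
    case 1
    show ?case by simp
  next
    case (2 D f Fstar w0 m b \<eta> M \<zeta> \<xi> T)
    then show ?case
      by (intro isarah_rate(1)[OF assms, of D f Fstar w0 b m \<eta> M \<zeta> \<xi> T]) blast+
  next
    case (3 D f Fstar w0 m b \<eta> M \<zeta> \<xi> T)
    note rate = isarah_rate(2)[OF assms 3(1,2) 3(3)[rule_format] 3(5,8,9,10,11)]
    show ?case
      using rate 3(4,6,8) by (simp add: K_def real_sqrt_divide)
  next
    case (4 D f Fstar w0 \<epsilon>)
    \<comment> \<open>These signs become available once a problem with the prescribed
      \<open>\<Delta>\<close> and \<open>G\<close> is given: \<open>Fstar\<close> bounds the
      objective at \<open>w0\<close>, and \<open>G\<close> is the integral of a square.\<close>
    then have "\<Delta> \<ge> 0" "G \<ge> 0"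
      by (auto simp: le_diff_eq)
    then have "K \<ge> 0"
      using assms by (simp add: K_def)
    with 4 obtain m b where mb: "0 < m" "N \<le> m" "real b = sqrt (real m + 1)" "K / real b \<le> \<epsilon>"
        "real (total_complexity m b) \<le> 3 * (K + real N + 3)\<^sup>2 * (1 / \<epsilon>\<^sup>2)"
      using exists_batch_size[of K \<epsilon> N] by blast
    show ?case
    proof (rule exI[of _ m], rule exI[of _ b], intro conjI allI impI mb N[rule_format])
      fix \<eta> and M :: "'w measure" and \<zeta> \<xi> T
      assume step: "step_lower L c m \<le> \<eta>" "\<eta> \<le> step_upper L m"
        and random: "isarah_randomness M D m b \<zeta> \<xi> T"
      note rate = isarah_rate[OF assms 4(1,2) 4(3)[rule_format] 4(5) mb(3) step random]
      show "integrable M (\<lambda>\<omega>. (norm (grad (objective D f) (isarah_output f w0 \<eta> b \<zeta> \<xi> T \<omega>)))\<^sup>2)"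
        by (rule rate)
      show "(\<integral>\<omega>. (norm (grad (objective D f) (isarah_output f w0 \<eta> b \<zeta> \<xi> T \<omega>)))\<^sup>2 \<partial>M) \<le> \<epsilon>"
        using rate(2) mb(4) 4(4,6) by (simp add: K_def)
    qed (use 4 in auto)
  qed
qed

end
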